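(* Let $B_n$ be a prime bouquet with $n\ge 3$ edges whose intersection graph is $F_{i,j,k}$ (so $n=i+j+k$), where either $j\ne 0$, or $j=0$ and $k\ge 2$. Let $N=n_1+n_2+n_3$, where $n_1=1$ if $i$ is odd and $n_1=0$ if $i$ is even; $n_2=1$ if $j$ is odd and $n_2=0$ if $j$ is even; $n_3=0$ if $k$ is odd and $n_3=1$ if $k$ is even. Then $$^{\partial}\varepsilon_{B_n}^{\times}(z)=\begin{cases} z^{n+1-N}+\sum\limits_{d=2}^{n}g_d z^d, & \text{if } N\ge 1,\\ z^{n}+\sum\limits_{d=2}^{n}g_d z^d, & \text{if } N=0,\end{cases}$$ where $$\begin{aligned} g_d=\;&\overline{\binom{i}{d-1-2\left\lfloor\frac{j+k}{2}\right\rfloor}}+\overline{\binom{j}{d-1-2\left\lfloor\frac{i+k}{2}\right\rfloor}}+\overline{\binom{k}{d-2\left\lceil\frac{i+j}{2}\right\rceil}}+\sum_{a=0}^{i-1}\binom{i}{a}\overline{\binom{j}{d-2-k-a}}\\ &+\sum_{a=0}^{i-1}\binom{i}{a}\overline{\binom{k}{d-2-j-a}}+\sum_{a=0}^{i}\sum_{b=0}^{j-1}\binom{i}{a}\binom{j}{b}\,\overline{\binom{k}{d-2-a-b}}.\end{aligned}$$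
   Context: A ribbon graph $G$ is a surface with boundary represented as the union of two finite sets of closed topological discs, vertex-discs $V(G)$ and edge-ribbons $E(G)$, such that: vertex-discs and edge-ribbons intersect in disjoint line segments; each such segment lies on the boundary of precisely one vertex-disc and precisely one edge-ribbon; every edge-ribbon contains exactly two such segments. All graphs are connected (loops and multiple edges allowed). Let $F(G)$ be the set of faces (boundary components of the surface) and $c(G)$ the number of connected components. The Euler genus is $\varepsilon(G)=2c(G)-|V(G)|+|E(G)|-|F(G)|$. For $A\subseteq E(G)$, the partial Petrial $G^{\times|A}$ is obtained by detaching one end of each edge-ribbon in $A$ from its incident vertex-disc, giving the edge a half-twist, and reattaching it. The partial Petrial polynomial is $^{\partial}\varepsilon_G^{\times}(z)=\sum_{A\subseteq E(G)}z^{\varepsilon(G^{\times|A})}$. The join $G_1\vee G_2$ of disjoint ribbon graphs is obtained by choosing, for each $i=1,2$, an arc $p_i$ on the boundary of a vertex-disc of $G_i$ between two consecutive ribbon ends, and identifying $p_1$ with $p_2$ so that the two vertex-discs merge into one. A ribbon graph $G$ is prime if there are no non-empty subgraphs $G_1,G_2$ (a ribbon graph is empty if its edge set is empty) with $G=G_1\vee G_2$. A bouquet is a ribbon graph with exactly one vertex-disc. Two edges (loops) of a bouquet are interlaced if their half-edges alternate in the cyclic order of half-edges around the vertex-disc. The intersection graph $I(B)$ of a bouquet $B$ has the loops of $B$ as vertices, two being adjacent if and only if the loops are interlaced. A graph $G$ is called $F_{i,j,k}$ (with $i\ge1$, $j\ge 0$, $k\ge 1$) if $V(G)$ is a disjoint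 union $V_1\cup V_2\cup V_3$ such that $G[V_1]\cong K_i$ and $G[V_2]\cong K_j$ are complete, there are no edges between $V_1$ and $V_2$, $V_3$ is an independent set with $|V_3|=k$, and every vertex of $V_3$ is adjacent to all vertices of $V_1\cup V_2$. Conventions: a sum $\sum_{a=c_1}^{c_2}$ with $c_1>c_2$ is $0$; $\binom{m}{r}=0$ if $r<0$ or $r>m$ or $m=0$; and $\overline{\binom{m}{r}}=\binom{m}{r}$ if $0\le r\le m-1$, while $\overline{\binom{m}{r}}=0$ if $r<0$ or $r\ge m$. *)

theory Defs
  imports "HOL-Computational_Algebra.Polynomial"
begin

section \<open>Ribbon graphs\<close>

text \<open>
  A ribbon graph is presented by a signed rotation system. Each vertex-disc carries an (arbitrary)
  orientation; \<open>rot G v\<close> lists the ribbon ends on its boundary circle in the order in which they are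
  met, and only matters up to cyclic rotation. The edge-ribbon \<open>e\<close> has the two ends \<open>(e, False)\<close>
  and \<open>(e, True)\<close>. It is in \<open>twisted G\<close> if it fails to respect the chosen orientations
  of the vertex-discs at its ends (for a loop: if disc and ribbon form a Moebius band).
  A vertex with empty rotation is an isolated vertex-disc.
\<close>

type_synonym 'e half_edge = "'e \<times> bool"

record ('v, 'e) ribbon_graph =
  verts :: "'v set"
  edges :: "'e set"
  rot :: "'v \<Rightarrow> 'e half_edge list"
  twisted :: "'e set"

definition ribbon_graph :: "('v, 'e) ribbon_graph \<Rightarrow> bool" where
  "ribbon_graph G \<longleftrightarrow>
     finite (verts G) \<and> finite (edges G) \<and> twisted G \<subseteq> edges G \<and>
     (\<forall>v\<in>verts G. distinct (rot G v)) \<and>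
     (\<forall>u\<in>verts G. \<forall>v\<in>verts G. u \<noteq> v \<longrightarrow> set (rot G u) \<inter> set (rot G v) = {}) \<and>
     (\<Union>v\<in>verts G. set (rot G v)) = edges G \<times> UNIV"

subsection \<open>Connected components, faces, Euler genus\<close>

definition adjacency :: "('v, 'e) ribbon_graph \<Rightarrow> ('v \<times> 'v) set" where
  "adjacency G = {(u, v). u \<in> verts G \<and> v \<in> verts G \<and>
     (\<exists>e\<in>edges G. \<exists>s. (e, s) \<in> set (rot G u) \<and> (e, \<not> s) \<in> set (rot G v))}"

definition components :: "('v, 'e) ribbon_graph \<Rightarrow> 'v set set" where
  "components G = verts G // ((adjacency G)\<^sup>* \<inter> verts G \<times> verts G)"

text \<open>
  A ribbon end meets its vertex-disc in a line segment; \<open>(h, False)\<close> and \<open>(h, True)\<close> are the first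
  and the second endpoint of the segment of \<open>h\<close>, with respect to the orientation of the disc. The
  boundary of the surface consists of the arcs of vertex-discs between consecutive ribbon ends, of
  the two free sides of each ribbon, and of the full circles bounding isolated vertex-discs.
  The free sides of an untwisted ribbon join endpoints of different kinds, those of a twisted one
  endpoints of the same kind.
\<close>

type_synonym 'e corner = "'e half_edge \<times> bool"

definition corners :: "('v, 'e) ribbon_graph \<Rightarrow> 'e corner set" where
  "corners G = (edges G \<times> UNIV) \<times> UNIV"

definition vertex_arcs :: "('v, 'e) ribbon_graph \<Rightarrow> ('e corner \<times> 'e corner) set" where
  "vertex_arcs G = {((rot G v ! p, True), (rot G v ! (Suc p mod length (rot G v)), False)) | v p.
     v \<in> verts G \<and> p < length (rot G v)}"

definition ribbon_sides :: "('v, 'e) ribbon_graph \<Rightarrow> ('e corner \<times> 'e corner) set" where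
  "ribbon_sides G = {(((e, False), s), ((e, True), if e \<in> twisted G then s else \<not> s)) | e s.
     e \<in> edges G}"

definition same_face :: "('v, 'e) ribbon_graph \<Rightarrow> ('e corner \<times> 'e corner) set" where
  "same_face G =
     (let R = vertex_arcs G \<union> ribbon_sides G in (R \<union> R\<inverse>)\<^sup>* \<inter> corners G \<times> corners G)"

definition num_faces :: "('v, 'e) ribbon_graph \<Rightarrow> nat" where
  "num_faces G = card (corners G // same_face G) + card {v \<in> verts G. rot G v = []}"

definition euler_genus :: "('v, 'e) ribbon_graph \<Rightarrow> int" where
  "euler_genus G =
     2 * int (card (components G)) - int (card (verts G)) + int (card (edges G)) - int (num_faces G)"

subsection \<open>Partial Petrials\<close>

text \<open>A half-twist changes the twistedness of exactly the ribbons in \<open>A\<close>.\<close>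

definition partial_petrial :: "('v, 'e) ribbon_graph \<Rightarrow> 'e set \<Rightarrow> ('v, 'e) ribbon_graph" where
  "partial_petrial G A = G\<lparr>twisted := (twisted G - A) \<union> (A - twisted G)\<rparr>"

text \<open>The conversion \<open>nat\<close> loses nothing, as the Euler genus of a ribbon graph is nonnegative.\<close>

definition partial_petrial_poly :: "('v, 'e) ribbon_graph \<Rightarrow> int poly" where
  "partial_petrial_poly G =
     (\<Sum>A\<in>Pow (edges G). monom 1 (nat (euler_genus (partial_petrial G A))))"

subsection \<open>Subgraphs, joins and primality\<close>

definition cyc_eq :: "'a list \<Rightarrow> 'a list \<Rightarrow> bool" where
  "cyc_eq xs ys \<longleftrightarrow> (\<exists>m. ys = rotate m xs)"

text \<open>A subgraph inherits the orientations of the vertex-discs.\<close>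

definition ribbon_subgraph :: "('v, 'e) ribbon_graph \<Rightarrow> ('v, 'e) ribbon_graph \<Rightarrow> bool" where
  "ribbon_subgraph H G \<longleftrightarrow>
     ribbon_graph H \<and> verts H \<subseteq> verts G \<and> edges H \<subseteq> edges G \<and>
     twisted H = twisted G \<inter> edges H \<and>
     (\<forall>v\<in>verts H. cyc_eq (rot H v) (filter (\<lambda>h. fst h \<in> edges H) (rot G v)))"

text \<open>
  \<open>is_join G1 G2 G\<close> means that \<open>G\<close> arises by merging one vertex-disc of \<open>G1\<close> with one of \<open>G2\<close>
  along an arc between consecutive ribbon ends; \<open>G1\<close> and \<open>G2\<close> are disjoint apart from the
  convention that these two discs, and the disc they are merged into, bear the same name \<open>v\<close>.
  Choosing the arcs amounts to choosing where to cut the two cyclic orders at \<open>v\<close> open.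
\<close>

definition is_join ::
    "('v, 'e) ribbon_graph \<Rightarrow> ('v, 'e) ribbon_graph \<Rightarrow> ('v, 'e) ribbon_graph \<Rightarrow> bool" where
  "is_join G1 G2 G \<longleftrightarrow>
     edges G1 \<inter> edges G2 = {} \<and> edges G = edges G1 \<union> edges G2 \<and>
     twisted G = twisted G1 \<union> twisted G2 \<and> verts G = verts G1 \<union> verts G2 \<and>
     (\<exists>v. verts G1 \<inter> verts G2 = {v} \<and>
        (\<forall>u\<in>verts G1 - {v}. cyc_eq (rot G u) (rot G1 u)) \<and>
        (\<forall>u\<in>verts G2 - {v}. cyc_eq (rot G u) (rot G2 u)) \<and>
        (\<exists>w1 w2. w1 \<noteq> [] \<and> w2 \<noteq> [] \<and> cyc_eq (rot G1 v) w1 \<and> cyc_eq (rot G2 v) w2 \<and>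
           cyc_eq (rot G v) (w1 @ w2)))"

definition prime_ribbon_graph :: "('v, 'e) ribbon_graph \<Rightarrow> bool" where
  "prime_ribbon_graph G \<longleftrightarrow>
     \<not> (\<exists>G1 G2. ribbon_subgraph G1 G \<and> ribbon_subgraph G2 G \<and>
          edges G1 \<noteq> {} \<and> edges G2 \<noteq> {} \<and> is_join G1 G2 G)"

section \<open>Bouquets and their intersection graphs\<close>

definition bouquet :: "('v, 'e) ribbon_graph \<Rightarrow> bool" where
  "bouquet B \<longleftrightarrow> ribbon_graph B \<and> card (verts B) = 1"

definition interlaced :: "('v, 'e) ribbon_graph \<Rightarrow> 'e \<Rightarrow> 'e \<Rightarrow> bool" where
  "interlaced B e f \<longleftrightarrow> e \<noteq> f \<and>
     map fst (filter (\<lambda>h. fst h \<in> {e, f}) (rot B (the_elem (verts B)))) \<in> {[e, f, e, f], [f, e, f, e]}"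

text \<open>Simple graphs are pairs of a vertex set and a set of two-element edges.\<close>

type_synonym 'a simple_graph = "'a set \<times> 'a set set"

definition intersection_graph :: "('v, 'e) ribbon_graph \<Rightarrow> 'e simple_graph" where
  "intersection_graph B =
     (edges B, {{e, f} | e f. e \<in> edges B \<and> f \<in> edges B \<and> interlaced B e f})"

definition is_F :: "nat \<Rightarrow> nat \<Rightarrow> nat \<Rightarrow> 'a simple_graph \<Rightarrow> bool" where
  "is_F i j k G \<longleftrightarrow> i \<ge> 1 \<and> k \<ge> 1 \<and>
     (\<exists>V1 V2 V3. finite (fst G) \<and> fst G = V1 \<union> V2 \<union> V3 \<and>
        V1 \<inter> V2 = {} \<and> V1 \<inter> V3 = {} \<and> V2 \<inter> V3 = {} \<and>
        card V1 = i \<and> card V2 = j \<and> card V3 = k \<and>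
        (\<forall>u\<in>V1. \<forall>v\<in>V1. u \<noteq> v \<longrightarrow> {u, v} \<in> snd G) \<and>
        (\<forall>u\<in>V2. \<forall>v\<in>V2. u \<noteq> v \<longrightarrow> {u, v} \<in> snd G) \<and>
        (\<forall>u\<in>V1. \<forall>v\<in>V2. {u, v} \<notin> snd G) \<and>
        (\<forall>u\<in>V3. \<forall>v\<in>V3. {u, v} \<notin> snd G) \<and>
        (\<forall>u\<in>V3. \<forall>v\<in>V1 \<union> V2. {u, v} \<in> snd G))"

section \<open>The coefficients\<close>

text \<open>Binomial coefficients with integer lower index; note that \<open>binom 0 0 = 0\<close>.\<close>

definition binom :: "nat \<Rightarrow> int \<Rightarrow> int" where
  "binom m r = (if r < 0 \<or> r > int m \<or> m = 0 then 0 else int (m choose nat r))"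

definition binom_bar :: "nat \<Rightarrow> int \<Rightarrow> int" where
  "binom_bar m r = (if 0 \<le> r \<and> r \<le> int m - 1 then binom m r else 0)"

definition g_coeff :: "nat \<Rightarrow> nat \<Rightarrow> nat \<Rightarrow> nat \<Rightarrow> int" where
  "g_coeff i j k d =
     binom_bar i (int d - 1 - 2 * \<lfloor>real (j + k) / 2\<rfloor>)
   + binom_bar j (int d - 1 - 2 * \<lfloor>real (i + k) / 2\<rfloor>)
   + binom_bar k (int d - 2 * \<lceil>real (i + j) / 2\<rceil>)
   + (\<Sum>a<i. binom i (int a) * binom_bar j (int d - 2 - int k - int a))
   + (\<Sum>a<i. binom i (int a) * binom_bar k (int d - 2 - int j - int a))
   + (\<Sum>a\<le>i. \<Sum>b<j. binom i (int a) * binom j (int b) * binom_bar k (int d - 2 - int a - int b))"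

end

theory Submission
  imports Defs
begin

text \<open>
  The Euler genus of a bouquet is the rank, over the field with two elements, of the adjacency matrix
  of its intersection graph with ones on the diagonal at the twisted loops. To see this, colour the
  boundary of the surface with two colours, constantly on every face. Walking around the vertex-disc,
  such a colouring is determined by the colour at the start and by the set \<open>S\<close> of loops at whose ends
  the colour changes, and \<open>S\<close> arises in this way if and only if it is the support of a kernel vector:
  the equation at \<open>e\<close> says that the colours fit along the free sides of the ribbon \<open>e\<close>. Hence
  \<open>2 ^ F = 2 * |kernel|\<close>, and Euler's formula turns this into \<open>|kernel| * 2 ^ genus = 2 ^ n\<close>
  (\<open>card_kernel_times_two_power_genus\<close>). Taking partial Petrials runs through all possible diagonals,
  so the polynomial is the generating function of the rank over all diagonals and depends on the
  intersection graph alone.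

  For the graph \<open>F\<close> the kernel equations couple the coordinates only through the parities of the
  vector on the three vertex classes. Given these parities, each coordinate is either forced or free,
  according to the diagonal entry, and the kernel is counted class by class
  (\<open>card_kernel_eq_sum_layers\<close>). The rank thereby becomes a function of the numbers \<open>a\<close>, \<open>b\<close>, \<open>c\<close>
  of forced coordinates in the three classes (\<open>F_rank\<close>). If every coordinate is forced, the rank is
  the exponent of the exceptional monomial, which involves \<open>N\<close>; otherwise it is \<open>a\<close>, \<open>b\<close> or \<open>c\<close>
  plus a constant, or \<open>a + b + c + 2\<close>, depending on the classes that contain free coordinates. These
  cases are the six sums of \<open>g_coeff\<close> (\<open>sum_g_coeff\<close>).
\<close>

section \<open>Sets saturated under an equivalence relation\<close>

text \<open>
  A saturated set is a union of classes, so choosing one amounts to choosing a set of classes.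
\<close>

lemma card_saturated_sets:
  assumes fin: "finite A" and eq: "equiv A r"
  shows "card {X. X \<subseteq> A \<and> (\<forall>(x, y)\<in>r. x \<in> X \<longleftrightarrow> y \<in> X)} = 2 ^ card (A // r)"
proof -
  have sub: "r \<subseteq> A \<times> A" and refl: "refl_on A r" and sy: "sym r"
    using eq unfolding equiv_def by auto
  have finq: "finite (A // r)"
    using fin eq by (meson finite_quotient sub)
  have "bij_betw Union (Pow (A // r)) {X. X \<subseteq> A \<and> (\<forall>(x, y)\<in>r. x \<in> X \<longleftrightarrow> y \<in> X)}"
  proof (rule bij_betwI')
    fix P Q assume P: "P \<in> Pow (A // r)" and Q: "Q \<in> Pow (A // r)"
    have sub: "P' \<subseteq> Q'" if PQ: "P' \<in> Pow (A // r)" "Q' \<in> Pow (A // r)" "\<Union> P' = \<Union> Q'" for P' Q'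
    proof
      fix Z assume Z: "Z \<in> P'"
      then obtain z where z: "z \<in> Z"
        using PQ(1) in_quotient_imp_non_empty[OF eq, of Z] by blast
      then obtain Y where Y: "Y \<in> Q'" "z \<in> Y" using PQ(3) Z by blast
      moreover have "Y \<in> A // r" "Z \<in> A // r" using Y Z PQ by auto
      ultimately have "Y = Z" using quotient_disj[OF eq, of Y Z] z by blast
      then show "Z \<in> Q'" using Y by simp
    qed
    show "(\<Union> P = \<Union> Q) = (P = Q)"
      using sub[OF P Q] sub[OF Q P] by (metis subset_antisym)
  next
    fix P assume P: "P \<in> Pow (A // r)"
    have "x \<in> \<Union> P \<longleftrightarrow> y \<in> \<Union> P" if "(x, y) \<in> r" for x y
    proof -
      have "(y, x) \<in> r" using that sy by (meson symD)
      then show ?thesis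
        using that P in_quotient_imp_closed[OF eq _ _ that]
          in_quotient_imp_closed[OF eq _ _ \<open>(y, x) \<in> r\<close>] by (meson PowD UnionE UnionI subsetD)
    qed
    moreover have "\<Union> P \<subseteq> A" using P Union_quotient[OF eq] by blast
    ultimately show "\<Union> P \<in> {X. X \<subseteq> A \<and> (\<forall>(x, y)\<in>r. x \<in> X \<longleftrightarrow> y \<in> X)}"
      unfolding mem_Collect_eq by (intro conjI ballI) (auto simp only: split_paired_all split_conv)
  next
    fix X assume X: "X \<in> {X. X \<subseteq> A \<and> (\<forall>(x, y)\<in>r. x \<in> X \<longleftrightarrow> y \<in> X)}"
    have "X = \<Union> ((\<lambda>x. r `` {x}) ` X)"
    proof
      show "X \<subseteq> \<Union> ((\<lambda>x. r `` {x}) ` X)" using X refl by (auto simp: refl_on_def)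
      show "\<Union> ((\<lambda>x. r `` {x}) ` X) \<subseteq> X" using X by auto
    qed
    moreover have "(\<lambda>x. r `` {x}) ` X \<in> Pow (A // r)"
      using X by (auto intro: quotientI)
    ultimately show "\<exists>P\<in>Pow (A // r). X = \<Union> P" by (rule bexI)
  qed
  from bij_betw_same_card[OF this] show ?thesis using finq by (simp add: card_Pow)
qed

lemma equiv_symmetric_closure:
  "equiv C ((R \<union> R\<inverse>)\<^sup>* \<inter> C \<times> C)"
proof (rule equivI)
  have "sym ((R \<union> R\<inverse>)\<^sup>*)" by (simp add: sym_rtrancl sym_Un_converse)
  then show "sym ((R \<union> R\<inverse>)\<^sup>* \<inter> C \<times> C)" by (auto simp: sym_def)
  show "trans ((R \<union> R\<inverse>)\<^sup>* \<inter> C \<times> C)" by (rule transI) auto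
qed (auto simp: refl_on_def)

lemma saturated_symmetric_closure_iff:
  assumes "R \<subseteq> C \<times> C"
  shows "(\<forall>(x, y)\<in>(R \<union> R\<inverse>)\<^sup>* \<inter> C \<times> C. x \<in> X \<longleftrightarrow> y \<in> X)
     \<longleftrightarrow> (\<forall>(x, y)\<in>R. x \<in> X \<longleftrightarrow> y \<in> X)"
proof
  assume R: "\<forall>(x, y)\<in>R. x \<in> X \<longleftrightarrow> y \<in> X"
  have "x \<in> X \<longleftrightarrow> y \<in> X" if "(x, y) \<in> (R \<union> R\<inverse>)\<^sup>*" for x y
    using that by (induction rule: rtrancl_induct) (use R in auto)
  then show "\<forall>(x, y)\<in>(R \<union> R\<inverse>)\<^sup>* \<inter> C \<times> C. x \<in> X \<longleftrightarrow> y \<in> X" by blast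
next
  assume "\<forall>(x, y)\<in>(R \<union> R\<inverse>)\<^sup>* \<inter> C \<times> C. x \<in> X \<longleftrightarrow> y \<in> X"
  moreover have "R \<subseteq> (R \<union> R\<inverse>)\<^sup>* \<inter> C \<times> C" using assms by auto
  ultimately show "\<forall>(x, y)\<in>R. x \<in> X \<longleftrightarrow> y \<in> X" by blast
qed

section \<open>Faces of a bouquet and the binary kernel of its intersection graph\<close>

text \<open>
  Over the field with two elements, take the adjacency matrix of \<open>R\<close> on \<open>V\<close> and put ones on the
  diagonal at \<open>D\<close>. The sets below are the supports of the vectors that this matrix kills.
\<close>

definition binary_kernel :: "('a \<Rightarrow> 'a \<Rightarrow> bool) \<Rightarrow> 'a set \<Rightarrow> 'a set \<Rightarrow> 'a set set" where
  "binary_kernel R V D =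
     {S. S \<subseteq> V \<and> (\<forall>e\<in>V. odd (card {f \<in> S. R e f}) \<longleftrightarrow> e \<in> D \<and> e \<in> S)}"

definition crossings :: "'e half_edge list \<Rightarrow> 'e set \<Rightarrow> nat \<Rightarrow> nat" where
  "crossings w S p = length (filter (\<lambda>h. fst h \<in> S) (take p w))"

text \<open>
  A subset of the corners, read as a two-valued function, that respects the arcs of the disc is
  determined by its value \<open>b\<close> just before the first ribbon end and by the set \<open>S\<close> of edges at whose
  ends the value flips. The function with these data is obtained by walking once around the disc.
\<close>

definition potential :: "'e half_edge list \<Rightarrow> bool \<times> 'e set \<Rightarrow> 'e corner set" where
  "potential w = (\<lambda>(b, S). {(w ! p, s) | p s. p < length w \<and>
     (b \<noteq> odd (crossings w S (if s then Suc p else p)))})"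

lemma crossings_0: "crossings w S 0 = 0"
  by (simp add: crossings_def)

lemma crossings_Suc:
  "p < length w \<Longrightarrow> crossings w S (Suc p) = crossings w S p + (if fst (w ! p) \<in> S then 1 else 0)"
  by (simp add: crossings_def take_Suc_conv_app_nth)

lemma mem_potential:
  assumes "distinct w" "p < length w"
  shows "(w ! p, s) \<in> potential w (b, S) \<longleftrightarrow> b \<noteq> odd (crossings w S (if s then Suc p else p))"
  using assms by (auto simp: potential_def nth_eq_iff_index_eq)

text \<open>
  The rotation of ribbon ends around the single vertex-disc of a bouquet.
\<close>

locale one_disc =
  fixes w :: "'e half_edge list" and E :: "'e set"
  assumes finite_E: "finite E" and distinct_w: "distinct w" and set_w: "set w = E \<times> UNIV"
begin

abbreviation interlace :: "'e \<Rightarrow> 'e \<Rightarrow> bool" where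
  "interlace e f \<equiv> e \<noteq> f \<and> map fst (filter (\<lambda>h. fst h \<in> {e, f}) w) \<in> {[e, f, e, f], [f, e, f, e]}"

lemma length_w: "length w = 2 * card E"
  using distinct_card[OF distinct_w] set_w by (simp add: card_cartesian_product)

text \<open>
  Both ends of an edge of \<open>S\<close> are met on a full turn around the disc, hence the value of a potential
  returns to where it started.
\<close>

lemma crossings_full:
  assumes "S \<subseteq> E"
  shows "even (crossings w S (length w))"
proof -
  have "{h. fst h \<in> S} \<inter> set w = S \<times> UNIV" using assms set_w by auto
  then show ?thesis
    by (simp add: crossings_def distinct_length_filter[OF distinct_w] card_cartesian_product)
qed

text \<open>
  The two ends of \<open>f\<close> are distributed over the three gaps \<open>u\<close>, \<open>m\<close>, \<open>t\<close> left by the ends of \<open>e\<close>,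
  and the word of \<open>e\<close> and \<open>f\<close> alternates precisely if one of them falls into \<open>m\<close>.
\<close>

lemma interlace_iff_odd_between:
  assumes w: "w = u @ (e, s) # m @ (e, \<not> s) # t" and f: "f \<in> E" "f \<noteq> e"
  shows "interlace e f \<longleftrightarrow> odd (length (filter (\<lambda>h. fst h = f) m))"
proof -
  define cnt where "cnt = (\<lambda>xs :: 'e half_edge list. length (filter (\<lambda>h. fst h = f) xs))"
  have no_e: "fst h \<noteq> e" if "h \<in> set u \<union> set m \<union> set t" for h
    using distinct_w that unfolding w by (cases h; cases "snd h"; cases s) auto
  have word: "map fst (filter (\<lambda>h. fst h = e \<or> fst h = f) xs) = replicate (cnt xs) f"
    if "set xs \<subseteq> set u \<union> set m \<union> set t" for xs
  proof -
    have "filter (\<lambda>h. fst h = e \<or> fst h = f) xs = filter (\<lambda>h. fst h = f) xs"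
      using that no_e by (intro filter_cong) auto
    moreover have "map fst (filter (\<lambda>h. fst h = f) xs) = replicate (cnt xs) f"
      unfolding cnt_def by (rule replicate_eqI[symmetric, THEN sym]) auto
    ultimately show ?thesis by simp
  qed
  have "{h. fst h = f} \<inter> set w = {f} \<times> UNIV" using f set_w by auto
  then have "cnt w = 2"
    by (simp add: cnt_def distinct_length_filter[OF distinct_w] card_cartesian_product)
  then have total: "cnt u + cnt m + cnt t = 2"
    using f by (simp add: w cnt_def)
  have whole: "map fst (filter (\<lambda>h. fst h \<in> {e, f}) w) =
      replicate (cnt u) f @ e # replicate (cnt m) f @ e # replicate (cnt t) f"
    using word[of u, OF order_trans[OF Un_upper1 Un_upper1]]
      word[of m, OF order_trans[OF Un_upper2 Un_upper1]] word[of t, OF Un_upper2]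
    by (simp add: w)
  have "cnt u = 0 \<and> cnt m = 0 \<and> cnt t = 2 \<or> cnt u = 0 \<and> cnt m = 2 \<and> cnt t = 0
      \<or> cnt u = 2 \<and> cnt m = 0 \<and> cnt t = 0 \<or> cnt u = 0 \<and> cnt m = 1 \<and> cnt t = 1
      \<or> cnt u = 1 \<and> cnt m = 0 \<and> cnt t = 1 \<or> cnt u = 1 \<and> cnt m = 1 \<and> cnt t = 0"
  proof -
    have "a = 0 \<and> b = 0 \<and> c = 2 \<or> a = 0 \<and> b = 2 \<and> c = 0 \<or> a = 2 \<and> b = 0 \<and> c = 0
      \<or> a = 0 \<and> b = 1 \<and> c = 1 \<or> a = 1 \<and> b = 0 \<and> c = 1 \<or> a = 1 \<and> b = 1 \<and> c = 0"
      if "a + b + c = 2" for a b c :: nat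
      using that by presburger
    from this[OF total] show ?thesis .
  qed
  moreover have "length (filter (\<lambda>h. fst h = f) m) = cnt m" by (simp add: cnt_def)
  ultimately show ?thesis
    unfolding whole
    by (elim disjE conjE) (use f in \<open>simp_all add: numeral_2_eq_2\<close>)
qed

text \<open>
  Modulo 2, an edge with both ends or no end between those of \<open>e\<close> contributes nothing; what remains
  are the edges interlaced with \<open>e\<close>.
\<close>

lemma odd_between_eq_odd_interlaced:
  assumes w: "w = u @ (e, s) # m @ (e, \<not> s) # t" and S: "S \<subseteq> E"
  shows "odd (length (filter (\<lambda>h. fst h \<in> S) m)) \<longleftrightarrow> odd (card {f \<in> S. interlace e f})"
proof -
  have fin: "finite S" using S finite_E by (rule finite_subset)
  have "length (filter (\<lambda>h. fst h \<in> S) xs) = (\<Sum>f\<in>S. length (filter (\<lambda>h. fst h = f) xs))"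
    for xs :: "'e half_edge list"
  proof (induction xs)
    case (Cons h xs)
    have "(\<Sum>f\<in>S. length (filter (\<lambda>h. fst h = f) (h # xs)))
        = (\<Sum>f\<in>S. (if fst h = f then 1 else 0) + length (filter (\<lambda>h. fst h = f) xs))"
      by (intro sum.cong) auto
    also have "\<dots> = (if fst h \<in> S then 1 else 0) + (\<Sum>f\<in>S. length (filter (\<lambda>h. fst h = f) xs))"
      using fin by (simp add: sum.distrib sum.delta')
    finally show ?case using Cons by simp
  qed simp
  then have "odd (length (filter (\<lambda>h. fst h \<in> S) m))
      \<longleftrightarrow> odd (card {f \<in> S. odd (length (filter (\<lambda>h. fst h = f) m))})"
    using even_sum_iff[OF fin] by simp
  also have "{f \<in> S. odd (length (filter (\<lambda>h. fst h = f) m))} = {f \<in> S. interlace e f}"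
  proof -
    have "filter (\<lambda>h. fst h = e) m = []"
    proof -
      have "fst h \<noteq> e" if "h \<in> set m" for h
        using distinct_w that unfolding w by (cases h; cases "snd h"; cases s) auto
      then show ?thesis by (auto simp: filter_empty_conv)
    qed
    then have "odd (length (filter (\<lambda>h. fst h = f) m)) \<longleftrightarrow> interlace e f" if "f \<in> S" for f
      using interlace_iff_odd_between[OF w, of f] that S by (cases "f = e") auto
    then show ?thesis by (intro Collect_cong conj_cong refl)
  qed
  finally show ?thesis .
qed

text \<open>
  Between the corners in front of the two ends of \<open>e\<close> the walk passes one end of \<open>e\<close> itself and the
  ends lying strictly between.
\<close>

lemma crossings_parity_at_ends:
  assumes p: "p < length w" "w ! p = (e, s)" and q: "q < length w" "w ! q = (e, \<not> s)"
    and S: "S \<subseteq> E"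
  shows "odd (crossings w S p) \<noteq> odd (crossings w S q)
     \<longleftrightarrow> ((e \<in> S) \<noteq> odd (card {f \<in> S. interlace e f}))"
proof -
  have ordered: "odd (crossings w S p) \<noteq> odd (crossings w S q)
     \<longleftrightarrow> ((e \<in> S) \<noteq> odd (card {f \<in> S. interlace e f}))"
    if p: "p < length w" "w ! p = (e, s)" and q: "q < length w" "w ! q = (e, \<not> s)" and "p < q"
    for p q s
  proof -
    define u where "u = take p w"
    define m where "m = take (q - Suc p) (drop (Suc p) w)"
    define t where "t = drop (Suc q) w"
    have tq: "take q w = u @ (e, s) # m"
    proof -
      have "take q w = take (Suc p + (q - Suc p)) w" using \<open>p < q\<close> by simp
      also have "\<dots> = take (Suc p) w @ m" by (simp only: take_add m_def)
      also have "take (Suc p) w = u @ [(e, s)]" using p by (simp add: take_Suc_conv_app_nth u_def)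
      finally show ?thesis by simp
    qed
    have w: "w = u @ (e, s) # m @ (e, \<not> s) # t"
      using id_take_nth_drop[OF q(1)] tq q(2) by (simp add: t_def)
    have "crossings w S q = crossings w S p + (if e \<in> S then 1 else 0)
        + length (filter (\<lambda>h. fst h \<in> S) m)"
      by (simp add: crossings_def tq flip: u_def)
    then show ?thesis
      using odd_between_eq_odd_interlaced[OF w S] by auto
  qed
  have "p \<noteq> q" using p q by auto
  then consider "p < q" | "q < p" by linarith
  then show ?thesis
  proof cases
    case 1
    then show ?thesis using ordered[OF p q] by simp
  next
    \<comment> \<open>the claim is symmetric in the two ends of the edge\<close>
    case 2
    then show ?thesis using ordered[OF q(1) q(2) p(1)] p(2) by auto
  qed
qed

definition disc_arcs :: "('e corner \<times> 'e corner) set" where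
  "disc_arcs = {((w ! p, True), (w ! (Suc p mod length w), False)) | p. p < length w}"

definition free_sides :: "'e set \<Rightarrow> ('e corner \<times> 'e corner) set" where
  "free_sides T = {(((e, False), s), ((e, True), if e \<in> T then s else \<not> s)) | e s. e \<in> E}"

text \<open>
  A set of corners is a union of faces if it does not separate corners joined along the boundary.
\<close>

definition face_unions :: "'e set \<Rightarrow> 'e corner set set" where
  "face_unions T = {X. X \<subseteq> (E \<times> UNIV) \<times> UNIV \<and>
     (\<forall>(x, y)\<in>disc_arcs \<union> free_sides T. x \<in> X \<longleftrightarrow> y \<in> X)}"

lemma position:
  assumes "e \<in> E"
  obtains p where "p < length w" "w ! p = (e, s)"
  using assms set_w by (metis SigmaI UNIV_I in_set_conv_nth)

lemma potential_respects_arcs: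
  assumes S: "S \<subseteq> E" and p: "p < length w"
  shows "(w ! p, True) \<in> potential w (b, S)
     \<longleftrightarrow> (w ! (Suc p mod length w), False) \<in> potential w (b, S)"
proof (cases "Suc p < length w")
  case True
  then show ?thesis using p distinct_w by (simp add: mem_potential)
next
  case False
  then have last: "Suc p = length w" using p by simp
  then have "Suc p mod length w = 0" by simp
  moreover have "0 < length w" using p by (rule le_less_trans[OF le0])
  ultimately show ?thesis
    using p distinct_w crossings_full[OF S] by (simp add: mem_potential crossings_0 last)
qed

text \<open>
  This is where the matrix appears. Both free sides of \<open>e\<close> impose the same condition on a potential,
  namely row \<open>e\<close> of the kernel equations: a side of an untwisted ribbon leads from in front of one end
  to behind the other, which cancels the flip at \<open>e\<close> itself, whereas a half-twist keeps this flip
  and so contributes the diagonal entry of \<open>e\<close>.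
\<close>

lemma potential_respects_sides_iff:
  assumes S: "S \<subseteq> E" and e: "e \<in> E"
  shows "(\<forall>s. ((e, False), s) \<in> potential w (b, S)
            \<longleftrightarrow> ((e, True), if e \<in> T then s else \<not> s) \<in> potential w (b, S))
     \<longleftrightarrow> (odd (card {f \<in> S. interlace e f}) \<longleftrightarrow> e \<in> T \<and> e \<in> S)"
proof -
  obtain p where p: "p < length w" "w ! p = (e, False)" using position[OF e] .
  obtain q where q: "q < length w" "w ! q = (e, True)" using position[OF e] .
  have F: "((e, False), s) \<in> potential w (b, S)
      \<longleftrightarrow> b \<noteq> (odd (crossings w S p) \<noteq> (s \<and> e \<in> S))" for s
    using mem_potential[OF distinct_w p(1), of s b S] crossings_Suc[OF p(1), of S] p(2) by auto
  have T: "((e, True), s) \<in> potential w (b, S)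
      \<longleftrightarrow> b \<noteq> (odd (crossings w S q) \<noteq> (s \<and> e \<in> S))" for s
    using mem_potential[OF distinct_w q(1), of s b S] crossings_Suc[OF q(1), of S] q(2) by auto
  have "odd (crossings w S p) \<noteq> odd (crossings w S q)
     \<longleftrightarrow> ((e \<in> S) \<noteq> odd (card {f \<in> S. interlace e f}))"
    using crossings_parity_at_ends[OF p q(1) _ S] q(2) by simp
  then show ?thesis
    unfolding F T all_bool_eq by argo
qed

lemma potential_in_face_unions_iff:
  assumes S: "S \<subseteq> E"
  shows "potential w (b, S) \<in> face_unions T \<longleftrightarrow> S \<in> binary_kernel interlace E T"
proof -
  let ?X = "potential w (b, S)"
  have "?X \<subseteq> (E \<times> UNIV) \<times> UNIV"
    using set_w by (force simp: potential_def dest: nth_mem)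
  moreover have "\<forall>(x, y)\<in>disc_arcs. x \<in> ?X \<longleftrightarrow> y \<in> ?X"
    using potential_respects_arcs[OF S] by (auto simp: disc_arcs_def)
  ultimately have "?X \<in> face_unions T \<longleftrightarrow> (\<forall>(x, y)\<in>free_sides T. x \<in> ?X \<longleftrightarrow> y \<in> ?X)"
    unfolding face_unions_def ball_Un by simp
  also have "\<dots> \<longleftrightarrow> (\<forall>e\<in>E. \<forall>s. ((e, False), s) \<in> ?X
      \<longleftrightarrow> ((e, True), if e \<in> T then s else \<not> s) \<in> ?X)"
    unfolding free_sides_def by (auto; blast)
  also have "\<dots> \<longleftrightarrow> S \<in> binary_kernel interlace E T"
    using S by (simp add: potential_respects_sides_iff binary_kernel_def)
  finally show ?thesis .
qed

text \<open>
  The two sides of a ribbon carry the same pair of values to the other end, so a union of faces flips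
  at both ends of an edge or at neither; this makes the set \<open>S\<close> of flipping edges well defined.
\<close>

lemma face_union_is_potential:
  assumes X: "X \<in> face_unions T"
  obtains b S where "S \<subseteq> E" "X = potential w (b, S)"
proof
  define S where "S = {e \<in> E. (((e, False), False) \<in> X) \<noteq> (((e, False), True) \<in> X)}"
  define b where "b \<longleftrightarrow> (w ! 0, False) \<in> X"
  show "S \<subseteq> E" by (auto simp: S_def)
  have arc: "(w ! p, True) \<in> X \<longleftrightarrow> (w ! (Suc p mod length w), False) \<in> X" if "p < length w" for p
    using X that unfolding face_unions_def disc_arcs_def by blast
  have side: "((e, False), s) \<in> X \<longleftrightarrow> ((e, True), if e \<in> T then s else \<not> s) \<in> X" if "e \<in> E" for e s
    using X that unfolding face_unions_def free_sides_def by blast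
  have jump: "(h, True) \<in> X \<longleftrightarrow> (((h, False) \<in> X) \<noteq> (fst h \<in> S))" if hw: "h \<in> set w" for h
  proof -
    obtain e s where h: "h = (e, s)" "e \<in> E" using hw set_w by auto
    then show ?thesis
      using side[of e False] side[of e True] by (cases s; cases "e \<in> T") (auto simp: S_def)
  qed
  have False_corner: "(w ! p, False) \<in> X \<longleftrightarrow> b \<noteq> odd (crossings w S p)" if "p < length w" for p
    using that
  proof (induction p)
    case 0
    then show ?case by (simp add: b_def crossings_0)
  next
    case (Suc p)
    then have "(w ! Suc p, False) \<in> X \<longleftrightarrow> (w ! p, True) \<in> X" using arc[of p] by simp
    then show ?case using Suc jump[of "w ! p"] crossings_Suc[of p w S] by auto
  qed
  have corner: "(w ! p, s) \<in> X \<longleftrightarrow> (w ! p, s) \<in> potential w (b, S)" if "p < length w" for p s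
    using False_corner[OF that] jump[of "w ! p"] crossings_Suc[OF that, of S]
      mem_potential[OF distinct_w that, of s b S] that
    by (cases s) auto
  have "X \<subseteq> set w \<times> UNIV" using X set_w by (auto simp: face_unions_def)
  moreover have "potential w (b, S) \<subseteq> set w \<times> UNIV" by (auto simp: potential_def)
  moreover have "c \<in> X \<longleftrightarrow> c \<in> potential w (b, S)" if c: "c \<in> set w \<times> UNIV" for c
  proof -
    obtain h s where "c = (h, s)" "h \<in> set w" using c by (cases c) auto
    moreover obtain p where "p < length w" "w ! p = h"
      using \<open>h \<in> set w\<close> by (metis in_set_conv_nth)
    ultimately show ?thesis using corner[of p s] by simp
  qed
  ultimately show "X = potential w (b, S)" by blast
qed

text \<open>
  The hypothesis excludes the bare disc: it has no corners, so the base value would be lost.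
\<close>

lemma inj_on_potential:
  assumes "E \<noteq> {}"
  shows "inj_on (potential w) (UNIV \<times> Pow E)"
proof (rule inj_onI, clarify)
  fix b b' S S' assume S: "S \<subseteq> E" "S' \<subseteq> E" and eq: "potential w (b, S) = potential w (b', S')"
  have "0 < length w" using assms finite_E by (simp add: length_w card_gt_0_iff)
  then have b: "b = b'"
    using mem_potential[OF distinct_w, of 0 False] eq by (metis crossings_0 even_zero)
  have "e \<in> S \<longleftrightarrow> e \<in> S'" if e: "e \<in> E" for e
  proof -
    obtain p where p: "p < length w" "w ! p = (e, False)" using position[OF e] .
    have "e \<in> R \<longleftrightarrow> (((w ! p, True) \<in> potential w (c, R)) \<noteq> ((w ! p, False) \<in> potential w (c, R)))"
      for c R
      using mem_potential[OF distinct_w p(1), of True c R]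
        mem_potential[OF distinct_w p(1), of False c R] crossings_Suc[OF p(1), of R] p(2) by auto
    then show ?thesis using eq by metis
  qed
  then show "b = b' \<and> S = S'" using b S by blast
qed

lemma bij_betw_potential:
  assumes "E \<noteq> {}"
  shows "bij_betw (potential w) (UNIV \<times> binary_kernel interlace E T) (face_unions T)"
proof (rule bij_betw_imageI)
  have sub: "binary_kernel interlace E T \<subseteq> Pow E" by (auto simp: binary_kernel_def)
  then show "inj_on (potential w) (UNIV \<times> binary_kernel interlace E T)"
    by (intro inj_on_subset[OF inj_on_potential[OF assms]]) auto
  show "potential w ` (UNIV \<times> binary_kernel interlace E T) = face_unions T"
  proof
    show "potential w ` (UNIV \<times> binary_kernel interlace E T) \<subseteq> face_unions T"
      using sub potential_in_face_unions_iff by blast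
    show "face_unions T \<subseteq> potential w ` (UNIV \<times> binary_kernel interlace E T)"
    proof
      fix X assume X: "X \<in> face_unions T"
      obtain b S where bS: "S \<subseteq> E" "X = potential w (b, S)" by (rule face_union_is_potential[OF X])
      then have "(b, S) \<in> UNIV \<times> binary_kernel interlace E T"
        using X potential_in_face_unions_iff by blast
      then show "X \<in> potential w ` (UNIV \<times> binary_kernel interlace E T)" using bS by blast
    qed
  qed
qed

end

text \<open>
  The rank-nullity theorem in disguise: the Euler genus of a bouquet is the rank of the matrix whose
  kernel is counted. The unions of faces number \<open>2 ^ num_faces G\<close> as subsets of the set of faces, and
  twice the size of the kernel as potentials; Euler's formula with one vertex and one component gives
  the rest.
\<close>

proposition card_kernel_times_two_power_genus:
  fixes G :: "('v, 'e) ribbon_graph"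
  assumes G: "bouquet G" and nonempty: "edges G \<noteq> {}"
  shows "card (binary_kernel (interlaced G) (edges G) (twisted G)) * 2 ^ nat (euler_genus G)
     = 2 ^ card (edges G)"
proof -
  let ?K = "binary_kernel (interlaced G) (edges G) (twisted G)"
  obtain v where v: "verts G = {v}"
    using G by (auto simp: bouquet_def card_1_singleton_iff)
  interpret one_disc "rot G v" "edges G"
    using G v by unfold_locales (auto simp: bouquet_def ribbon_graph_def)
  have interlaced: "interlaced G = interlace" by (intro ext) (simp add: interlaced_def v)
  have rot: "rot G v \<noteq> []" using nonempty length_w finite_E by auto
  have arcs: "vertex_arcs G = disc_arcs" by (simp add: vertex_arcs_def disc_arcs_def v)
  have sides: "ribbon_sides G = free_sides (twisted G)"
    by (simp add: ribbon_sides_def free_sides_def)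
  define R where "R = disc_arcs \<union> free_sides (twisted G)"
  have "rot G v ! p \<in> edges G \<times> UNIV" if "p < length (rot G v)" for p
    using nth_mem[OF that] set_w by simp
  moreover have "Suc p mod length (rot G v) < length (rot G v)" for p
    using rot by simp
  ultimately have "disc_arcs \<subseteq> corners G \<times> corners G"
    unfolding disc_arcs_def corners_def by blast
  then have R: "R \<subseteq> corners G \<times> corners G"
    by (auto simp: R_def free_sides_def corners_def)
  have same: "same_face G = (R \<union> R\<inverse>)\<^sup>* \<inter> corners G \<times> corners G"
    by (simp add: same_face_def Let_def arcs sides R_def)
  have "face_unions (twisted G)
      = {X. X \<subseteq> corners G \<and> (\<forall>(x, y)\<in>same_face G. x \<in> X \<longleftrightarrow> y \<in> X)}"
    unfolding same saturated_symmetric_closure_iff[OF R] by (simp add: face_unions_def R_def corners_def)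
  moreover have "finite (corners G)" using finite_E by (simp add: corners_def)
  ultimately have "card (face_unions (twisted G)) = 2 ^ card (corners G // same_face G)"
    using card_saturated_sets[of "corners G" "same_face G"] equiv_symmetric_closure[of "corners G" R]
    by (simp add: same)
  also have "card (corners G // same_face G) = num_faces G"
    using rot by (simp add: num_faces_def v)
  finally have faces: "2 * card ?K = 2 ^ num_faces G"
    using bij_betw_same_card[OF bij_betw_potential[OF nonempty, of "twisted G"]]
    by (simp add: interlaced card_cartesian_product)
  have "card ?K \<le> card (Pow (edges G))"
    using finite_E by (intro card_mono) (auto simp: binary_kernel_def)
  then have "(2 :: nat) ^ num_faces G \<le> 2 ^ Suc (card (edges G))"
    using faces finite_E by (simp add: card_Pow)
  then have le: "num_faces G \<le> Suc (card (edges G))" by (simp only: power_increasing_iff)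
  have "components G = {{v}}"
    by (auto simp: components_def v quotient_def)
  then have genus: "nat (euler_genus G) = Suc (card (edges G)) - num_faces G"
    using le by (simp add: euler_genus_def v)
  have "2 * (card ?K * 2 ^ nat (euler_genus G)) = 2 ^ (num_faces G + nat (euler_genus G))"
    by (simp add: power_add faces flip: mult.assoc)
  also have "\<dots> = 2 * 2 ^ card (edges G)" using le by (simp add: genus)
  finally show ?thesis by simp
qed

section \<open>The kernel for the graphs F\<close>

lemma card_subsets_of_parity:
  assumes "finite A" "A \<noteq> {}"
  shows "card {S. S \<subseteq> A \<and> (odd (card S) \<longleftrightarrow> t)} = 2 ^ (card A - 1)"
proof -
  have halves: "card {S. S \<subseteq> A \<and> even (card S)} = card {S. S \<subseteq> A \<and> odd (card S)}"
    using card_subsupersets_even_odd[of A "{}"] assms by auto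
  have "{S. S \<subseteq> A \<and> even (card S)} \<union> {S. S \<subseteq> A \<and> odd (card S)} = Pow A" by auto
  moreover have "card ({S. S \<subseteq> A \<and> even (card S)} \<union> {S. S \<subseteq> A \<and> odd (card S)})
      = card {S. S \<subseteq> A \<and> even (card S)} + card {S. S \<subseteq> A \<and> odd (card S)}"
    using assms(1) by (intro card_Un_disjoint) auto
  ultimately have "2 * card {S. S \<subseteq> A \<and> odd (card S)} = 2 ^ card A"
    using halves assms(1) by (simp add: card_Pow)
  also have "\<dots> = 2 * 2 ^ (card A - 1)"
    using assms by (simp add: card_gt_0_iff flip: power_Suc)
  finally show ?thesis using halves by (cases t) simp_all
qed

text \<open>
  The part of a kernel vector in one of the three vertex classes. At a vertex of \<open>M\<close> the kernel
  equation forces the coordinate to be \<open>\<alpha>\<close>, a parity common to the whole class; at the other vertices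
  the coordinate drops out of the equation, which then reads \<open>\<alpha> = 0\<close> and leaves the coordinate free.
\<close>

definition layer :: "'a set \<Rightarrow> 'a set \<Rightarrow> bool \<Rightarrow> bool \<Rightarrow> 'a set set" where
  "layer V M \<alpha> t = {S. S \<subseteq> V \<and>
     (\<forall>v\<in>V. if v \<in> M then v \<in> S \<longleftrightarrow> \<alpha> else \<not> \<alpha>) \<and> (odd (card S) \<longleftrightarrow> t)}"

lemma finite_layer: "finite V \<Longrightarrow> finite (layer V M \<alpha> t)"
  unfolding layer_def by (rule finite_subset[of _ "Pow V"]) auto

lemma card_layer:
  assumes "finite V" "M \<subseteq> V"
  shows "card (layer V M \<alpha> t) =
    (if card M = card V then if t \<longleftrightarrow> \<alpha> \<and> odd (card V) then 1 else 0
     else if \<alpha> then 0 else 2 ^ (card V - card M - 1))"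
proof (cases "M = V")
  case True
  have "layer V M \<alpha> t = (if t \<longleftrightarrow> \<alpha> \<and> odd (card V) then {if \<alpha> then V else {}} else {})"
  proof -
    have "S \<subseteq> V \<and> (\<forall>v\<in>V. v \<in> S \<longleftrightarrow> \<alpha>) \<longleftrightarrow> S = (if \<alpha> then V else {})" for S by auto
    then have "layer V M \<alpha> t = {S. S = (if \<alpha> then V else {}) \<and> (odd (card S) \<longleftrightarrow> t)}"
      unfolding layer_def True by (simp only: if_True simp_thms conj_assoc[symmetric] cong: ball_cong)
    then show ?thesis by auto
  qed
  then show ?thesis
    using True by (cases \<alpha>; cases t; cases "odd (card V)") simp_all
next
  case False
  then have "card M \<noteq> card V" using assms by (metis card_subset_eq)
  moreover have "layer V M \<alpha> t = (if \<alpha> then {} else {S. S \<subseteq> V - M \<and> (odd (card S) \<longleftrightarrow> t)})"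
  proof -
    obtain v where "v \<in> V" "v \<notin> M" using False assms by blast
    then have "layer V M True t = {}" unfolding layer_def by auto
    moreover have "layer V M False t = {S. S \<subseteq> V - M \<and> (odd (card S) \<longleftrightarrow> t)}"
    proof -
      have "S \<subseteq> V \<and> (\<forall>v\<in>V. if v \<in> M then v \<in> S \<longleftrightarrow> False else \<not> False) \<longleftrightarrow> S \<subseteq> V - M" for S
        using assms(2) by auto
      then show ?thesis unfolding layer_def conj_assoc[symmetric] by (intro Collect_cong conj_cong refl)
    qed
    ultimately show ?thesis by (cases \<alpha>) simp_all
  qed
  moreover have "V - M \<noteq> {}" "finite (V - M)" using False assms by auto
  ultimately show ?thesis
    using card_subsets_of_parity[of "V - M" t] assms
    by (simp add: card_Diff_subset finite_subset)
qed

text \<open>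
  The graph \<open>F\<close> with \<open>i\<close>, \<open>j\<close>, \<open>k\<close> the sizes of the two cliques and of the independent class.
\<close>

locale F_partition =
  fixes R :: "'a \<Rightarrow> 'a \<Rightarrow> bool" and V1 V2 V3 :: "'a set"
  assumes finite: "finite V1" "finite V2" "finite V3"
    and disjoint: "V1 \<inter> V2 = {}" "V1 \<inter> V3 = {}" "V2 \<inter> V3 = {}"
    and clique1: "\<And>u v. u \<in> V1 \<Longrightarrow> v \<in> V1 \<Longrightarrow> R u v \<longleftrightarrow> u \<noteq> v"
    and clique2: "\<And>u v. u \<in> V2 \<Longrightarrow> v \<in> V2 \<Longrightarrow> R u v \<longleftrightarrow> u \<noteq> v"
    and independent: "\<And>u v. u \<in> V3 \<Longrightarrow> v \<in> V3 \<Longrightarrow> \<not> R u v"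
    and separated: "\<And>u v. u \<in> V1 \<Longrightarrow> v \<in> V2 \<Longrightarrow> \<not> R u v \<and> \<not> R v u"
    and joined: "\<And>u v. u \<in> V1 \<union> V2 \<Longrightarrow> v \<in> V3 \<Longrightarrow> R u v \<and> R v u"
begin

abbreviation V :: "'a set" where "V \<equiv> V1 \<union> V2 \<union> V3"

lemma not_mem_other:
  "v \<in> V1 \<Longrightarrow> v \<notin> V2" "v \<in> V1 \<Longrightarrow> v \<notin> V3" "v \<in> V2 \<Longrightarrow> v \<notin> V1"
  "v \<in> V2 \<Longrightarrow> v \<notin> V3" "v \<in> V3 \<Longrightarrow> v \<notin> V1" "v \<in> V3 \<Longrightarrow> v \<notin> V2"
  using disjoint unfolding disjoint_iff by blast+

lemma odd_card_clique_remove: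
  assumes "finite S"
  shows "odd (card (S - {v})) \<longleftrightarrow> (odd (card S) \<noteq> (v \<in> S))"
proof (cases "v \<in> S")
  case True
  with assms have "card S = Suc (card (S - {v}))" by (rule card.remove)
  then show ?thesis using True by simp
qed simp

lemma odd_neighbours:
  assumes S: "S1 \<subseteq> V1" "S2 \<subseteq> V2" "S3 \<subseteq> V3"
  defines "S \<equiv> S1 \<union> S2 \<union> S3"
  shows "v \<in> V1 \<Longrightarrow> odd (card {f \<in> S. R v f}) \<longleftrightarrow> ((odd (card S1) \<noteq> (v \<in> S1)) \<noteq> odd (card S3))"
    and "v \<in> V2 \<Longrightarrow> odd (card {f \<in> S. R v f}) \<longleftrightarrow> ((odd (card S2) \<noteq> (v \<in> S2)) \<noteq> odd (card S3))"
    and "v \<in> V3 \<Longrightarrow> odd (card {f \<in> S. R v f}) \<longleftrightarrow> (odd (card S1) \<noteq> odd (card S2))"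
proof -
  have fin: "finite S1" "finite S2" "finite S3" using S finite finite_subset by blast+
  have disj12: "S1 \<inter> S2 = {}" and disj13: "(S1 - {v}) \<inter> S3 = {}" and disj23: "(S2 - {v}) \<inter> S3 = {}"
    using S disjoint by blast+
  have union: "odd (card (A \<union> B)) \<longleftrightarrow> (odd (card A) \<noteq> odd (card B))"
    if "finite A" "finite B" "A \<inter> B = {}" for A B :: "'a set"
    using that by (simp add: card_Un_disjoint)
  {
    assume v: "v \<in> V1"
    have "{f \<in> S. R v f} = (S1 - {v}) \<union> S3"
      using v S clique1[of v] separated[of v] joined[of v] unfolding S_def by blast
    then show "odd (card {f \<in> S. R v f}) \<longleftrightarrow> ((odd (card S1) \<noteq> (v \<in> S1)) \<noteq> odd (card S3))"
      using union[of "S1 - {v}" S3] odd_card_clique_remove[OF fin(1), of v] fin disj13 by simp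
  next
    assume v: "v \<in> V2"
    have "{f \<in> S. R v f} = (S2 - {v}) \<union> S3"
      using v S clique2[of v] separated[of _ v] joined[of v] unfolding S_def by blast
    then show "odd (card {f \<in> S. R v f}) \<longleftrightarrow> ((odd (card S2) \<noteq> (v \<in> S2)) \<noteq> odd (card S3))"
      using union[of "S2 - {v}" S3] odd_card_clique_remove[OF fin(2), of v] fin disj23 by simp
  next
    assume v: "v \<in> V3"
    have "{f \<in> S. R v f} = S1 \<union> S2"
      using v S independent[of v] joined[of _ v] unfolding S_def by blast
    then show "odd (card {f \<in> S. R v f}) \<longleftrightarrow> (odd (card S1) \<noteq> odd (card S2))"
      using union[of S1 S2] fin disj12 by simp
  }
qed

text \<open>
  The kernel equation at a vertex involves the rest of the vector only through the parities of its
  three parts: for the cliques it reads \<open>x + d x = \<alpha>\<close> and \<open>x + d x = \<beta>\<close> with \<open>d\<close> the diagonal entry,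
  for the independent class \<open>d x = \<alpha> + \<beta>\<close>. A coordinate is therefore forced where \<open>d = 0\<close> in the
  cliques but where \<open>d = 1\<close> in the independent class, which explains the shape of the diagonal below.
\<close>

lemma mem_kernel_iff_layers:
  assumes S: "S1 \<subseteq> V1" "S2 \<subseteq> V2" "S3 \<subseteq> V3"
    and M: "M1 \<subseteq> V1" "M2 \<subseteq> V2" "M3 \<subseteq> V3"
    and \<alpha>: "\<alpha> \<longleftrightarrow> odd (card S1) \<noteq> odd (card S3)"
    and \<beta>: "\<beta> \<longleftrightarrow> odd (card S2) \<noteq> odd (card S3)"
  shows "S1 \<union> S2 \<union> S3 \<in> binary_kernel R V ((V1 - M1) \<union> (V2 - M2) \<union> M3) \<longleftrightarrow>
    S1 \<in> layer V1 M1 \<alpha> (odd (card S1)) \<and> S2 \<in> layer V2 M2 \<beta> (odd (card S2)) \<and>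
    S3 \<in> layer V3 M3 (\<alpha> \<noteq> \<beta>) (odd (card S3))"
proof -
  let ?S = "S1 \<union> S2 \<union> S3" and ?D = "(V1 - M1) \<union> (V2 - M2) \<union> M3"
  let ?ok = "\<lambda>v. odd (card {f \<in> ?S. R v f}) \<longleftrightarrow> v \<in> ?D \<and> v \<in> ?S"
  have "?ok v \<longleftrightarrow> (if v \<in> M1 then v \<in> S1 \<longleftrightarrow> \<alpha> else \<not> \<alpha>)" if v: "v \<in> V1" for v
  proof -
    have "v \<notin> V2" "v \<notin> V3" using not_mem_other[of v] v by simp_all
    then have "v \<notin> M2" "v \<notin> M3" "v \<notin> S2" "v \<notin> S3"
      using M S by (meson subsetD)+
    then have "v \<in> ?D \<longleftrightarrow> v \<notin> M1" "v \<in> ?S \<longleftrightarrow> v \<in> S1"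
      using v \<open>v \<notin> V2\<close> \<open>v \<notin> V3\<close> by simp_all
    then show ?thesis using odd_neighbours(1)[OF S v] unfolding \<alpha> by argo
  qed
  moreover have "?ok v \<longleftrightarrow> (if v \<in> M2 then v \<in> S2 \<longleftrightarrow> \<beta> else \<not> \<beta>)" if v: "v \<in> V2" for v
  proof -
    have "v \<notin> V1" "v \<notin> V3" using not_mem_other[of v] v by simp_all
    then have "v \<notin> M1" "v \<notin> M3" "v \<notin> S1" "v \<notin> S3"
      using M S by (meson subsetD)+
    then have "v \<in> ?D \<longleftrightarrow> v \<notin> M2" "v \<in> ?S \<longleftrightarrow> v \<in> S2"
      using v \<open>v \<notin> V1\<close> \<open>v \<notin> V3\<close> by simp_all
    then show ?thesis using odd_neighbours(2)[OF S v] unfolding \<beta> by argo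
  qed
  moreover have "?ok v \<longleftrightarrow> (if v \<in> M3 then v \<in> S3 \<longleftrightarrow> (\<alpha> \<noteq> \<beta>) else \<not> (\<alpha> \<noteq> \<beta>))" if v: "v \<in> V3" for v
  proof -
    have "v \<notin> V1" "v \<notin> V2" using not_mem_other[of v] v by simp_all
    then have "v \<notin> M1" "v \<notin> M2" "v \<notin> S1" "v \<notin> S2"
      using M S by (meson subsetD)+
    then have "v \<in> ?D \<longleftrightarrow> v \<in> M3" "v \<in> ?S \<longleftrightarrow> v \<in> S3"
      using v \<open>v \<notin> V1\<close> \<open>v \<notin> V2\<close> by simp_all
    then show ?thesis using odd_neighbours(3)[OF S v] unfolding \<alpha> \<beta> by argo
  qed
  moreover have "?S \<subseteq> V" using S by auto
  ultimately show ?thesis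
    using S unfolding binary_kernel_def layer_def ball_Un by simp
qed

text \<open>
  Fixing \<open>\<alpha>\<close>, \<open>\<beta>\<close> and the parity \<open>t\<close> of the part in the third class makes the three parts
  independent of each other. The parities of the first two parts are then \<open>\<alpha> + t\<close> and \<open>\<beta> + t\<close>.
\<close>

lemma card_kernel_eq_sum_layers:
  assumes M: "M1 \<subseteq> V1" "M2 \<subseteq> V2" "M3 \<subseteq> V3"
  shows "card (binary_kernel R V ((V1 - M1) \<union> (V2 - M2) \<union> M3)) =
    (\<Sum>(\<alpha>, \<beta>, t)\<in>UNIV. card (layer V1 M1 \<alpha> (\<alpha> \<noteq> t)) * card (layer V2 M2 \<beta> (\<beta> \<noteq> t))
      * card (layer V3 M3 (\<alpha> \<noteq> \<beta>) t))"
proof -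
  define P where "P = (\<lambda>(\<alpha>, \<beta>, t). layer V1 M1 \<alpha> (\<alpha> \<noteq> t) \<times> layer V2 M2 \<beta> (\<beta> \<noteq> t)
      \<times> layer V3 M3 (\<alpha> \<noteq> \<beta>) t)"
  define J where "J = (\<lambda>(c :: bool \<times> bool \<times> bool, S1 :: 'a set, S2 :: 'a set, S3 :: 'a set). S1 \<union> S2 \<union> S3)"
  let ?K = "binary_kernel R V ((V1 - M1) \<union> (V2 - M2) \<union> M3)"
  have dest: "S1 \<subseteq> V1 \<and> S2 \<subseteq> V2 \<and> S3 \<subseteq> V3 \<and> \<alpha> = (odd (card S1) \<noteq> odd (card S3)) \<and>
      \<beta> = (odd (card S2) \<noteq> odd (card S3)) \<and> t = odd (card S3)"
    if "((\<alpha>, \<beta>, t), S1, S2, S3) \<in> Sigma UNIV P" for \<alpha> \<beta> t S1 S2 S3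
    using that unfolding P_def layer_def by auto
  have "bij_betw J (Sigma UNIV P) ?K"
  proof (rule bij_betw_imageI)
    show "inj_on J (Sigma UNIV P)"
    proof (rule inj_onI)
      fix x y assume x: "x \<in> Sigma UNIV P" and y: "y \<in> Sigma UNIV P" and eq: "J x = J y"
      obtain \<alpha> \<beta> t S1 S2 S3 where x': "x = ((\<alpha>, \<beta>, t), S1, S2, S3)" by (metis prod.exhaust)
      obtain \<alpha>' \<beta>' t' T1 T2 T3 where y': "y = ((\<alpha>', \<beta>', t'), T1, T2, T3)" by (metis prod.exhaust)
      note dx = dest[OF x[unfolded x']] and dy = dest[OF y[unfolded y']]
      have eq: "S1 \<union> S2 \<union> S3 = T1 \<union> T2 \<union> T3" using eq by (simp add: J_def x' y')
      have "(S1 \<union> S2 \<union> S3) \<inter> V1 = S1" "(S1 \<union> S2 \<union> S3) \<inter> V2 = S2" "(S1 \<union> S2 \<union> S3) \<inter> V3 = S3"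
        using dx disjoint by blast+
      moreover have "(T1 \<union> T2 \<union> T3) \<inter> V1 = T1" "(T1 \<union> T2 \<union> T3) \<inter> V2 = T2" "(T1 \<union> T2 \<union> T3) \<inter> V3 = T3"
        using dy disjoint by blast+
      ultimately have "S1 = T1" "S2 = T2" "S3 = T3" using eq by simp_all
      then show "x = y" using dx dy x' y' by simp
    qed
    show "J ` Sigma UNIV P = ?K"
    proof
      show "J ` Sigma UNIV P \<subseteq> ?K"
      proof
        fix S assume "S \<in> J ` Sigma UNIV P"
        then obtain \<alpha> \<beta> t S1 S2 S3 where x: "((\<alpha>, \<beta>, t), S1, S2, S3) \<in> Sigma UNIV P"
          and S: "S = S1 \<union> S2 \<union> S3" by (auto simp: J_def)
        note d = dest[OF x]
        have "S1 \<in> layer V1 M1 \<alpha> (odd (card S1)) \<and> S2 \<in> layer V2 M2 \<beta> (odd (card S2)) \<and>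
            S3 \<in> layer V3 M3 (\<alpha> \<noteq> \<beta>) (odd (card S3))"
          using x unfolding P_def by (auto simp: layer_def)
        then show "S \<in> ?K" using mem_kernel_iff_layers[OF _ _ _ M] d S by simp
      qed
      show "?K \<subseteq> J ` Sigma UNIV P"
      proof
        fix S assume SK: "S \<in> ?K"
        define S1 S2 S3 where "S1 = S \<inter> V1" and "S2 = S \<inter> V2" and "S3 = S \<inter> V3"
        define \<alpha> \<beta> where "\<alpha> \<longleftrightarrow> odd (card S1) \<noteq> odd (card S3)" and "\<beta> \<longleftrightarrow> odd (card S2) \<noteq> odd (card S3)"
        have sub: "S1 \<subseteq> V1" "S2 \<subseteq> V2" "S3 \<subseteq> V3" by (auto simp: S1_def S2_def S3_def)
        have S: "S = S1 \<union> S2 \<union> S3"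
          using SK by (auto simp: binary_kernel_def S1_def S2_def S3_def)
        have "odd (card S1) = (\<alpha> \<noteq> odd (card S3))" "odd (card S2) = (\<beta> \<noteq> odd (card S3))"
          by (auto simp: \<alpha>_def \<beta>_def)
        then have "((\<alpha>, \<beta>, odd (card S3)), S1, S2, S3) \<in> Sigma UNIV P"
          using mem_kernel_iff_layers[OF sub M \<alpha>_def \<beta>_def] SK S by (simp add: P_def)
        moreover have "S = J ((\<alpha>, \<beta>, odd (card S3)), S1, S2, S3)" by (simp add: J_def S)
        ultimately show "S \<in> J ` Sigma UNIV P" by (rule rev_image_eqI)
      qed
    qed
  qed
  then have "card ?K = card (Sigma UNIV P)" by (simp add: bij_betw_same_card)
  also have "\<dots> = (\<Sum>c\<in>UNIV. card (P c))"
    by (intro card_SigmaI) (auto simp: P_def finite_layer finite)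
  also have "\<dots> = (\<Sum>(\<alpha>, \<beta>, t)\<in>UNIV. card (layer V1 M1 \<alpha> (\<alpha> \<noteq> t))
      * card (layer V2 M2 \<beta> (\<beta> \<noteq> t)) * card (layer V3 M3 (\<alpha> \<noteq> \<beta>) t))"
    by (intro sum.cong) (auto simp: P_def card_cartesian_product)
  finally show ?thesis .
qed

end

section \<open>The rank for the graphs F\<close>

definition parity_defect :: "nat \<Rightarrow> nat \<Rightarrow> nat \<Rightarrow> nat" where
  "parity_defect i j k = (if odd i then 1 else 0) + (if odd j then 1 else 0) + (if odd k then 0 else 1)"

text \<open>
  The rank of the matrix of the graph \<open>F\<close> when \<open>a\<close>, \<open>b\<close>, \<open>c\<close> coordinates of the three classes are
  forced. A class with a free coordinate has its parity constant equal to zero; the cases record which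
  classes consist of forced coordinates only. If all do, the kernel is cut out of the plane of pairs
  \<open>(\<alpha>, \<beta>)\<close> and has dimension \<open>parity_defect - 1\<close>, or 0 if the parity defect is 0, which the
  truncated subtraction takes care of.
\<close>

definition F_rank :: "nat \<Rightarrow> nat \<Rightarrow> nat \<Rightarrow> nat \<Rightarrow> nat \<Rightarrow> nat \<Rightarrow> nat" where
  "F_rank i j k a b c =
    (if a = i \<and> b = j \<and> c = k then i + j + k - (parity_defect i j k - 1)
     else if b = j \<and> c = k then a + (1 + 2 * ((j + k) div 2))
     else if a = i \<and> c = k then b + (1 + 2 * ((i + k) div 2))
     else if a = i \<and> b = j then c + 2 * ((i + j + 1) div 2)
     else a + b + c + 2)"

lemma sum_bool_triple:
  fixes f :: "bool \<Rightarrow> bool \<Rightarrow> bool \<Rightarrow> nat"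
  shows "(\<Sum>(\<alpha>, \<beta>, t)\<in>UNIV. f \<alpha> \<beta> t) =
    f False False False + f False False True + f False True False + f False True True
    + f True False False + f True False True + f True True False + f True True True"
  by (simp add: UNIV_Times_UNIV[symmetric] sum.cartesian_product[symmetric] UNIV_bool
      del: UNIV_Times_UNIV)

text \<open>
  Here \<open>L\<close> is the number of vectors in a layer. A class with a free coordinate leaves only the terms
  in which its constant vanishes, and one dimension of it is used up by prescribing the parity.
\<close>

lemma F_rank_arith:
  fixes i j k a b c :: nat
  defines "L \<equiv> \<lambda>m r \<alpha> t. if r = m then if t \<longleftrightarrow> \<alpha> \<and> odd m then 1 else 0
     else if \<alpha> then 0 else (2 :: nat) ^ (m - r - 1)"
  assumes "a \<le> i" "b \<le> j" "c \<le> k"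
  shows "(\<Sum>(\<alpha>, \<beta>, t)\<in>UNIV. L i a \<alpha> (\<alpha> \<noteq> t) * L j b \<beta> (\<beta> \<noteq> t) * L k c (\<alpha> \<noteq> \<beta>) t)
      * 2 ^ F_rank i j k a b c = 2 ^ (i + j + k)"
proof -
  have even_half: "2 * (x div 2) = (if odd x then x - 1 else x)" for x :: nat by presburger
  have full: "L m m \<alpha> t = (if t \<longleftrightarrow> \<alpha> \<and> odd m then 1 else 0)" for m \<alpha> t
    by (simp add: L_def)
  have partial: "L (r + Suc p) r \<alpha> t = (if \<alpha> then 0 else 2 ^ p)" for r p \<alpha> t
    by (simp add: L_def)
  have cases: "x = y \<or> (\<exists>p. y = x + Suc p)" if "x \<le> y" for x y :: nat
    using that by presburger
  have pos: "odd x \<Longrightarrow> x > 0" for x :: nat by (rule odd_pos)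
  \<comment> \<open>the letters \<open>p\<close>, \<open>q\<close>, \<open>r\<close> are the exponents of the layers with free coordinates\<close>
  consider "a = i" "b = j" "c = k" | p where "i = a + Suc p" "b = j" "c = k"
    | q where "a = i" "j = b + Suc q" "c = k" | r where "a = i" "b = j" "k = c + Suc r"
    | p q where "i = a + Suc p" "j = b + Suc q" "c = k" | p r where "i = a + Suc p" "b = j" "k = c + Suc r"
    | q r where "a = i" "j = b + Suc q" "k = c + Suc r"
    | p q r where "i = a + Suc p" "j = b + Suc q" "k = c + Suc r"
    using cases[OF assms(2)] cases[OF assms(3)] cases[OF assms(4)] by blast
  then show ?thesis
  proof cases
    case 1
    show ?thesis unfolding 1 sum_bool_triple full F_rank_def parity_defect_def
      using pos[of i] pos[of j] pos[of k]
      by (cases "odd i"; cases "odd j"; cases "odd k")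
         (auto elim!: oddE simp: power_add)
  next
    case 2
    show ?thesis unfolding 2 sum_bool_triple full partial F_rank_def even_half
      by (cases "odd j"; cases "odd k") (auto elim!: oddE simp: power_add)
  next
    case 3
    show ?thesis unfolding 3 sum_bool_triple full partial F_rank_def even_half
      by (cases "odd i"; cases "odd k") (auto elim!: oddE simp: power_add)
  next
    case 4
    show ?thesis unfolding 4 sum_bool_triple full partial F_rank_def even_half
      by (cases "odd i"; cases "odd j") (auto elim!: oddE simp: power_add)
  next
    case 5
    show ?thesis unfolding 5 sum_bool_triple full partial F_rank_def by (simp add: power_add)
  next
    case 6
    show ?thesis unfolding 6 sum_bool_triple full partial F_rank_def by (simp add: power_add)
  next
    case 7
    show ?thesis unfolding 7 sum_bool_triple full partial F_rank_def by (simp add: power_add)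
  next
    case 8
    show ?thesis unfolding 8 sum_bool_triple full partial F_rank_def by (simp add: power_add)
  qed
qed

lemma (in F_partition) card_kernel_times_two_power_F_rank:
  assumes M: "M1 \<subseteq> V1" "M2 \<subseteq> V2" "M3 \<subseteq> V3"
  shows "card (binary_kernel R V ((V1 - M1) \<union> (V2 - M2) \<union> M3))
      * 2 ^ F_rank (card V1) (card V2) (card V3) (card M1) (card M2) (card M3)
    = 2 ^ (card V1 + card V2 + card V3)"
  unfolding card_kernel_eq_sum_layers[OF M]
    card_layer[OF finite(1) M(1)] card_layer[OF finite(2) M(2)] card_layer[OF finite(3) M(3)]
  by (rule F_rank_arith) (use M finite in \<open>auto intro: card_mono\<close>)

section \<open>Summation over all partial Petrials\<close>

lemma sum_Pow_card:
  fixes f :: "nat \<Rightarrow> int poly"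
  assumes "finite V"
  shows "(\<Sum>M\<in>Pow V. f (card M)) = (\<Sum>a\<le>card V. smult (int (card V choose a)) (f a))"
proof -
  have "(\<Sum>M\<in>Pow V. f (card M)) = (\<Sum>a\<le>card V. \<Sum>M | M \<in> Pow V \<and> card M = a. f (card M))"
    by (rule sum.group[symmetric]) (use assms in \<open>auto intro: card_mono\<close>)
  also have "\<dots> = (\<Sum>a\<le>card V. smult (int (card V choose a)) (f a))"
  proof (rule sum.cong[OF refl])
    fix a
    have "(\<Sum>M | M \<in> Pow V \<and> card M = a. f (card M)) = (\<Sum>M | M \<subseteq> V \<and> card M = a. f a)"
      by (intro sum.cong) auto
    also have "\<dots> = smult (int (card V choose a)) (f a)"
      using n_subsets[OF assms, of a] by (simp add: of_nat_mult_conv_smult)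
    finally show "(\<Sum>M | M \<in> Pow V \<and> card M = a. f (card M)) = smult (int (card V choose a)) (f a)" .
  qed
  finally show ?thesis .
qed

text \<open>
  The barred coefficient omits the top index \<open>m\<close>, hence runs over the proper subsets of an
  \<open>m\<close>-element class. The hypothesis says that the shifted exponents \<open>c, ..., c + m - 1\<close> stay
  within \<open>2, ..., n\<close>; for \<open>m = 0\<close> both sides vanish because \<open>binom 0 0 = 0\<close>.
\<close>

lemma sum_binom_bar:
  assumes "m = 0 \<or> 2 \<le> c \<and> c + m \<le> Suc n"
  shows "(\<Sum>d=2..n. monom (binom_bar m (int d - int c)) d) = (\<Sum>r<m. monom (int (m choose r)) (r + c))"
proof -
  have zero: "binom_bar m (int d - int c) = 0" if "d \<notin> {c..<c + m}" for d
    using that by (auto simp: binom_bar_def)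
  have "(\<Sum>d=2..n. monom (binom_bar m (int d - int c)) d)
      = (\<Sum>d\<in>{c..<c + m}. monom (binom_bar m (int d - int c)) d)"
    by (rule sum.mono_neutral_right) (use assms zero in auto)
  also have "\<dots> = (\<Sum>r<m. monom (binom_bar m (int (r + c) - int c)) (r + c))"
    using sum.shift_bounds_nat_ivl[of "\<lambda>d. monom (binom_bar m (int d - int c)) d" 0 c m]
    by (simp add: atLeast0LessThan add.commute)
  also have "\<dots> = (\<Sum>r<m. monom (int (m choose r)) (r + c))"
    by (intro sum.cong) (auto simp: binom_bar_def binom_def)
  finally show ?thesis .
qed

text \<open>
  Separating the indices that take their maximal value from the others yields eight sums. The last one
  below merges two of them, \<open>a < i\<close> and \<open>a = i\<close>, since \<open>F_rank\<close> has the same form on both.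
\<close>

lemma sum_triple_split_top:
  fixes T :: "nat \<Rightarrow> nat \<Rightarrow> nat \<Rightarrow> 'b :: comm_monoid_add"
  shows "(\<Sum>a\<le>i. \<Sum>b\<le>j. \<Sum>c\<le>k. T a b c) = T i j k
    + ((\<Sum>a<i. T a j k) + (\<Sum>b<j. T i b k) + (\<Sum>c<k. T i j c)
    + (\<Sum>a<i. \<Sum>b<j. T a b k) + (\<Sum>a<i. \<Sum>c<k. T a j c) + (\<Sum>a\<le>i. \<Sum>b<j. \<Sum>c<k. T a b c))"
proof -
  have top: "(\<Sum>x\<le>m. f x) = (\<Sum>x<m. f x) + f m" for f :: "nat \<Rightarrow> 'b" and m
    by (simp flip: lessThan_Suc_atMost)
  show ?thesis by (simp add: top sum.distrib ac_simps)
qed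

lemma smult_sum_right: "smult c (sum f A) = (\<Sum>x\<in>A. smult c (f x))"
  by (induction A rule: infinite_finite_induct) (simp_all add: smult_add_right)

lemma floor_half: "\<lfloor>real m / 2\<rfloor> = int (m div 2)"
  using floor_divide_of_nat_eq[of m 2, where 'a = real] by simp

lemma ceiling_half: "\<lceil>real m / 2\<rceil> = int ((m + 1) div 2)"
  by (rule ceiling_unique) (cases "even m"; auto elim!: evenE oddE)+

text \<open>
  The six sums in \<open>g_coeff\<close> are the six ways in which some class has a free coordinate, listed by the
  classes that are entirely forced: the third and second, the third and first, the first and second,
  the third, the second, and finally at most the first. The assumptions keep the exponents at least 2.
\<close>

lemma sum_g_coeff:
  assumes i: "1 \<le> i" and jk: "2 \<le> j + k" and k: "1 \<le> k"
  defines "T \<equiv> \<lambda>a b c. monom (int (i choose a) * int (j choose b) * int (k choose c)) (F_rank i j k a b c)"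
  shows "(\<Sum>a\<le>i. \<Sum>b\<le>j. \<Sum>c\<le>k. T a b c)
    = monom 1 (i + j + k - (parity_defect i j k - 1)) + (\<Sum>d=2..i+j+k. monom (g_coeff i j k d) d)"
proof -
  let ?n = "i + j + k"
  let ?bar = "\<lambda>m c. (\<Sum>d=2..?n. monom (binom_bar m (int d - int c)) d)"
  have choose: "binom m (int a) = int (m choose a)" if "a \<le> m" "m \<noteq> 0" for m a
    using that by (simp add: binom_def)
  have g: "g_coeff i j k d = binom_bar i (int d - int (1 + 2 * ((j + k) div 2)))
      + binom_bar j (int d - int (1 + 2 * ((i + k) div 2)))
      + binom_bar k (int d - int (2 * ((i + j + 1) div 2)))
      + (\<Sum>a<i. int (i choose a) * binom_bar j (int d - int (2 + k + a)))
      + (\<Sum>a<i. int (i choose a) * binom_bar k (int d - int (2 + j + a)))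
      + (\<Sum>a\<le>i. \<Sum>b<j. int (i choose a) * int (j choose b) * binom_bar k (int d - int (2 + a + b)))" for d
    unfolding g_coeff_def floor_half ceiling_half
    using i by (simp add: choose algebra_simps)
  have "(\<Sum>d=2..?n. monom (g_coeff i j k d) d) =
      ?bar i (1 + 2 * ((j + k) div 2)) + ?bar j (1 + 2 * ((i + k) div 2)) + ?bar k (2 * ((i + j + 1) div 2))
      + (\<Sum>a<i. smult (int (i choose a)) (?bar j (2 + k + a)))
      + (\<Sum>a<i. smult (int (i choose a)) (?bar k (2 + j + a)))
      + (\<Sum>a\<le>i. \<Sum>b<j. smult (int (i choose a) * int (j choose b)) (?bar k (2 + a + b)))"
    unfolding g smult_sum_right smult_monom add_monom[symmetric] monom_sum sum.distrib
    by (simp only: sum.swap[of _ "{2..?n}"])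
  also have "?bar i (1 + 2 * ((j + k) div 2)) = (\<Sum>a<i. T a j k)"
    using jk by (subst sum_binom_bar) (auto simp: T_def F_rank_def intro!: sum.cong)
  also have "?bar j (1 + 2 * ((i + k) div 2)) = (\<Sum>b<j. T i b k)"
    using i k by (subst sum_binom_bar) (auto simp: T_def F_rank_def intro!: sum.cong)
  also have "?bar k (2 * ((i + j + 1) div 2)) = (\<Sum>c<k. T i j c)"
    using i by (subst sum_binom_bar) (auto simp: T_def F_rank_def intro!: sum.cong)
  also have "(\<Sum>a<i. smult (int (i choose a)) (?bar j (2 + k + a))) = (\<Sum>a<i. \<Sum>b<j. T a b k)"
  proof (rule sum.cong[OF refl])
    fix a assume "a \<in> {..<i}"
    then show "smult (int (i choose a)) (?bar j (2 + k + a)) = (\<Sum>b<j. T a b k)"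
      by (subst sum_binom_bar)
         (auto simp: T_def F_rank_def smult_sum_right smult_monom add_ac intro!: sum.cong)
  qed
  also have "(\<Sum>a<i. smult (int (i choose a)) (?bar k (2 + j + a))) = (\<Sum>a<i. \<Sum>c<k. T a j c)"
  proof (rule sum.cong[OF refl])
    fix a assume "a \<in> {..<i}"
    then show "smult (int (i choose a)) (?bar k (2 + j + a)) = (\<Sum>c<k. T a j c)"
      by (subst sum_binom_bar)
         (auto simp: T_def F_rank_def smult_sum_right smult_monom add_ac intro!: sum.cong)
  qed
  also have "(\<Sum>a\<le>i. \<Sum>b<j. smult (int (i choose a) * int (j choose b)) (?bar k (2 + a + b)))
      = (\<Sum>a\<le>i. \<Sum>b<j. \<Sum>c<k. T a b c)"
  proof (intro sum.cong refl)
    fix a b assume "a \<in> {..i}" "b \<in> {..<j}"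
    then show "smult (int (i choose a) * int (j choose b)) (?bar k (2 + a + b)) = (\<Sum>c<k. T a b c)"
      by (subst sum_binom_bar)
         (auto simp: T_def F_rank_def smult_sum_right smult_monom add_ac intro!: sum.cong)
  qed
  finally have "(\<Sum>d=2..?n. monom (g_coeff i j k d) d) =
      (\<Sum>a<i. T a j k) + (\<Sum>b<j. T i b k) + (\<Sum>c<k. T i j c) + (\<Sum>a<i. \<Sum>b<j. T a b k)
      + (\<Sum>a<i. \<Sum>c<k. T a j c) + (\<Sum>a\<le>i. \<Sum>b<j. \<Sum>c<k. T a b c)" .
  moreover have "T i j k = monom 1 (?n - (parity_defect i j k - 1))"
    by (simp add: T_def F_rank_def)
  ultimately show ?thesis by (simp only: sum_triple_split_top[of T])
qed

section \<open>The partial Petrial polynomial\<close>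

lemma bouquet_partial_petrial:
  assumes "bouquet B" "A \<subseteq> edges B"
  shows "bouquet (partial_petrial B A)"
  using assms by (auto simp: bouquet_def ribbon_graph_def partial_petrial_def)

lemma interlaced_partial_petrial: "interlaced (partial_petrial B A) = interlaced B"
  by (intro ext) (simp add: interlaced_def partial_petrial_def)

lemma edge_intersection_graph_iff:
  "{u, v} \<in> snd (intersection_graph B) \<longleftrightarrow> u \<in> edges B \<and> v \<in> edges B \<and> interlaced B u v"
proof -
  have "interlaced B u v \<longleftrightarrow> interlaced B v u" for u v
    by (auto simp: interlaced_def insert_commute)
  then show ?thesis by (auto simp: intersection_graph_def doubleton_eq_iff)
qed

lemma is_F_imp_F_partition:
  assumes "is_F i j k (intersection_graph B)"
  obtains V1 V2 V3 where "F_partition (interlaced B) V1 V2 V3" "edges B = V1 \<union> V2 \<union> V3"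
    "card V1 = i" "card V2 = j" "card V3 = k"
proof -
  let ?I = "intersection_graph B"
  obtain V1 V2 V3 where fin: "finite (fst ?I)" and un: "fst ?I = V1 \<union> V2 \<union> V3"
    and disj: "V1 \<inter> V2 = {}" "V1 \<inter> V3 = {}" "V2 \<inter> V3 = {}"
    and card: "card V1 = i" "card V2 = j" "card V3 = k"
    and adj: "\<forall>u\<in>V1. \<forall>v\<in>V1. u \<noteq> v \<longrightarrow> {u, v} \<in> snd ?I"
      "\<forall>u\<in>V2. \<forall>v\<in>V2. u \<noteq> v \<longrightarrow> {u, v} \<in> snd ?I"
      "\<forall>u\<in>V1. \<forall>v\<in>V2. {u, v} \<notin> snd ?I" "\<forall>u\<in>V3. \<forall>v\<in>V3. {u, v} \<notin> snd ?I"
      "\<forall>u\<in>V3. \<forall>v\<in>V1 \<union> V2. {u, v} \<in> snd ?I"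
    using assms unfolding is_F_def by (elim conjE exE)
  have E: "edges B = V1 \<union> V2 \<union> V3" using un by (simp add: intersection_graph_def)
  have iff: "{u, v} \<in> snd ?I \<longleftrightarrow> interlaced B u v" "{u, v} \<in> snd ?I \<longleftrightarrow> interlaced B v u"
    if "u \<in> V1 \<union> V2 \<union> V3" "v \<in> V1 \<union> V2 \<union> V3" for u v
    using edge_intersection_graph_iff[of u v B] edge_intersection_graph_iff[of v u B] that E
    by (auto simp: insert_commute)
  have irrefl: "\<not> interlaced B u u" for u by (simp add: interlaced_def)
  have "F_partition (interlaced B) V1 V2 V3"
  proof
    show "finite V1" "finite V2" "finite V3" using fin un by auto
    show "interlaced B u v \<longleftrightarrow> u \<noteq> v" if "u \<in> V1" "v \<in> V1" for u v
      using that adj(1) iff(1)[of u v] irrefl by blast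
    show "interlaced B u v \<longleftrightarrow> u \<noteq> v" if "u \<in> V2" "v \<in> V2" for u v
      using that adj(2) iff(1)[of u v] irrefl by blast
    show "\<not> interlaced B u v" if "u \<in> V3" "v \<in> V3" for u v
      using that adj(4) iff(1)[of u v] by blast
    show "\<not> interlaced B u v \<and> \<not> interlaced B v u" if "u \<in> V1" "v \<in> V2" for u v
      using that adj(3) iff[of u v] by blast
    show "interlaced B u v \<and> interlaced B v u" if "u \<in> V1 \<union> V2" "v \<in> V3" for u v
      using that adj(5) iff[of v u] by blast
  qed (use disj in auto)
  then show ?thesis using E card by (rule that)
qed

text \<open>
  As \<open>A\<close> runs through all subsets of the edges, so does the set of twisted edges of the partial
  Petrial, and with it the triple of sets of forced coordinates. The genus depends only on the sizes of
  these three sets.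
\<close>

lemma partial_petrial_poly_F:
  fixes B :: "('v, 'e) ribbon_graph"
  assumes B: "bouquet B" and nonempty: "edges B \<noteq> {}"
    and "F_partition (interlaced B) V1 V2 V3" and E: "edges B = V1 \<union> V2 \<union> V3"
  shows "partial_petrial_poly B =
    (\<Sum>a\<le>card V1. \<Sum>b\<le>card V2. \<Sum>c\<le>card V3.
       monom (int (card V1 choose a) * int (card V2 choose b) * int (card V3 choose c))
         (F_rank (card V1) (card V2) (card V3) a b c))"
proof -
  interpret F_partition "interlaced B" V1 V2 V3 by fact
  let ?r = "\<lambda>a b c. monom 1 (F_rank (card V1) (card V2) (card V3) a b c) :: int poly"
  let ?tw = "twisted B"
  define petrie where "petrie A = (?tw - A) \<union> (A - ?tw)" for A
  have tw: "?tw \<subseteq> edges B" using B by (simp add: bouquet_def ribbon_graph_def)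
  have cardE: "card (edges B) = card V1 + card V2 + card V3"
    unfolding E using finite disjoint by (simp add: card_Un_disjoint Int_Un_distrib2)
  have invol: "petrie (petrie A) = A" for A by (auto simp: petrie_def)
  have genus: "nat (euler_genus (partial_petrial B A))
      = F_rank (card V1) (card V2) (card V3) (card (V1 - petrie A)) (card (V2 - petrie A)) (card (V3 \<inter> petrie A))"
    if A: "A \<subseteq> edges B" for A
  proof -
    let ?D = "petrie A" and ?P = "partial_petrial B A"
    let ?K = "binary_kernel (interlaced B) (V1 \<union> V2 \<union> V3) ?D"
    let ?F = "F_rank (card V1) (card V2) (card V3) (card (V1 - ?D)) (card (V2 - ?D)) (card (V3 \<inter> ?D))"
    have "?D \<subseteq> V1 \<union> V2 \<union> V3" using A tw E by (auto simp: petrie_def)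
    then have D: "(V1 - (V1 - ?D)) \<union> (V2 - (V2 - ?D)) \<union> (V3 \<inter> ?D) = ?D" by blast
    have "edges ?P \<noteq> {}" "edges ?P = V1 \<union> V2 \<union> V3" "twisted ?P = ?D"
      using nonempty E by (simp_all add: partial_petrial_def petrie_def)
    then have "card ?K * 2 ^ nat (euler_genus ?P) = 2 ^ card (edges B)"
      using card_kernel_times_two_power_genus[OF bouquet_partial_petrial[OF B A]] E
      by (simp add: interlaced_partial_petrial)
    moreover have "card ?K * 2 ^ ?F = 2 ^ card (edges B)"
      using card_kernel_times_two_power_F_rank[of "V1 - ?D" "V2 - ?D" "V3 \<inter> ?D"]
      unfolding D cardE by blast
    \<comment> \<open>both exponents complement the dimension of the same kernel\<close>
    moreover from this have "card ?K \<noteq> 0" by (intro notI) simp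
    ultimately show ?thesis by (metis mult_left_cancel one_less_numeral_iff power_inject_exp semiring_norm(76))
  qed
  have "partial_petrial_poly B = (\<Sum>A\<in>Pow (edges B).
      ?r (card (V1 - petrie A)) (card (V2 - petrie A)) (card (V3 \<inter> petrie A)))"
    unfolding partial_petrial_poly_def by (intro sum.cong) (simp_all add: genus)
  also have "\<dots> = (\<Sum>(M1, M2, M3)\<in>Pow V1 \<times> Pow V2 \<times> Pow V3. ?r (card M1) (card M2) (card M3))"
  proof (rule sum.reindex_bij_witness[where
        i = "\<lambda>(M1, M2, M3). petrie ((V1 - M1) \<union> (V2 - M2) \<union> M3)" and
        j = "\<lambda>A. (V1 - petrie A, V2 - petrie A, V3 \<inter> petrie A)"])
    have sub: "petrie A \<subseteq> edges B" if "A \<subseteq> edges B" for A using tw that by (auto simp: petrie_def)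
    fix A assume A: "A \<in> Pow (edges B)"
    then have "(V1 - (V1 - petrie A)) \<union> (V2 - (V2 - petrie A)) \<union> (V3 \<inter> petrie A) = petrie A"
      using sub[of A] E by blast
    then show "(case (V1 - petrie A, V2 - petrie A, V3 \<inter> petrie A) of
        (M1, M2, M3) \<Rightarrow> petrie ((V1 - M1) \<union> (V2 - M2) \<union> M3)) = A"
      by (simp add: invol)
  next
    fix M assume "M \<in> Pow V1 \<times> Pow V2 \<times> Pow V3"
    then obtain M1 M2 M3 where M: "M = (M1, M2, M3)" "M1 \<subseteq> V1" "M2 \<subseteq> V2" "M3 \<subseteq> V3" by auto
    let ?D = "(V1 - M1) \<union> (V2 - M2) \<union> M3"
    have "V1 - ?D = M1" "V2 - ?D = M2" "V3 \<inter> ?D = M3"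
      using M(2-4) not_mem_other by blast+
    then show "(case case M of (M1, M2, M3) \<Rightarrow> petrie ((V1 - M1) \<union> (V2 - M2) \<union> M3) of
        A \<Rightarrow> (V1 - petrie A, V2 - petrie A, V3 \<inter> petrie A)) = M"
      by (simp add: M(1) invol)
    have "?D \<subseteq> edges B" using M E by auto
    then show "(case M of (M1, M2, M3) \<Rightarrow> petrie ((V1 - M1) \<union> (V2 - M2) \<union> M3)) \<in> Pow (edges B)"
      using tw by (auto simp: M(1) petrie_def)
  qed auto
  also have "\<dots> = (\<Sum>M1\<in>Pow V1. \<Sum>M2\<in>Pow V2. \<Sum>M3\<in>Pow V3. ?r (card M1) (card M2) (card M3))"
    by (simp add: sum.cartesian_product)
  also have "\<dots> = (\<Sum>a\<le>card V1. smult (int (card V1 choose a)) (\<Sum>b\<le>card V2. smult (int (card V2 choose b))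
      (\<Sum>c\<le>card V3. smult (int (card V3 choose c)) (?r a b c))))"
  proof -
    let ?s3 = "\<lambda>a b. \<Sum>c\<le>card V3. smult (int (card V3 choose c)) (?r a b c)"
    let ?s2 = "\<lambda>a. \<Sum>b\<le>card V2. smult (int (card V2 choose b)) (?s3 a b)"
    have "(\<Sum>M3\<in>Pow V3. ?r a b (card M3)) = ?s3 a b" for a b
      by (rule sum_Pow_card[OF finite(3), of "?r a b"])
    moreover have "(\<Sum>M2\<in>Pow V2. ?s3 a (card M2)) = ?s2 a" for a
      by (rule sum_Pow_card[OF finite(2), of "?s3 a"])
    ultimately show ?thesis
      using sum_Pow_card[OF finite(1), of ?s2] by (simp only:)
  qed
  finally show ?thesis by (simp add: smult_sum_right smult_monom mult.assoc)
qed

theorem theorem4p6: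
  fixes B :: "('v, 'e) ribbon_graph" and n i j k n1 n2 n3 N :: nat
  assumes "bouquet B" and "prime_ribbon_graph B"
    and "card (edges B) = n" and "n \<ge> 3"
    and "is_F i j k (intersection_graph B)"
    and "j \<noteq> 0 \<or> (j = 0 \<and> k \<ge> 2)"
    and "n1 = (if odd i then 1 else 0)"
    and "n2 = (if odd j then 1 else 0)"
    and "n3 = (if odd k then 0 else 1)"
    and "N = n1 + n2 + n3"
  shows "partial_petrial_poly B =
    (if N \<ge> 1 then monom 1 (n + 1 - N) + (\<Sum>d=2..n. monom (g_coeff i j k d) d)
     else monom 1 n + (\<Sum>d=2..n. monom (g_coeff i j k d) d))"
proof -
  obtain V1 V2 V3 where F: "F_partition (interlaced B) V1 V2 V3" and E: "edges B = V1 \<union> V2 \<union> V3"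
    and card: "card V1 = i" "card V2 = j" "card V3 = k"
    by (rule is_F_imp_F_partition[OF assms(5)])
  interpret F_partition "interlaced B" V1 V2 V3 by (rule F)
  have n: "n = i + j + k"
    unfolding assms(3)[symmetric] E card[symmetric]
    using finite disjoint by (simp add: card_Un_disjoint Int_Un_distrib2)
  have ik: "1 \<le> i" "1 \<le> k" using assms(5) by (simp_all add: is_F_def)
  then have jk: "2 \<le> j + k" using assms(6) by linarith
  have N: "N = parity_defect i j k" using assms(7-10) by (simp add: parity_defect_def)
  have nonempty: "edges B \<noteq> {}" using assms(3,4) by auto
  have "partial_petrial_poly B
      = monom 1 (n - (N - 1)) + (\<Sum>d=2..n. monom (g_coeff i j k d) d)"
    unfolding partial_petrial_poly_F[OF assms(1) nonempty F E] card n N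
    by (rule sum_g_coeff[OF ik(1) jk ik(2)])
  then show ?thesis by (cases N) simp_all
qed

end
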